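(* Let $n,m,c$ be positive integers such that $G_{n,m}$ is not $c$-colorable and $c\ge 9288$. Then any tree resolution proof that $GRID(n,m,c)$ is unsatisfiable has size at least $2^{Dc}$, where $D=0.836$.
   Context: $[x]=\{1,\ldots,x\}$, $G_{n,m}=[n]\times[m]$. A rectangle is a subset $\{(a,b),(a+c_1,b),(a+c_1,b+c_2),(a,b+c_2)\}\subseteq G_{n,m}$ with $a,b,c_1,c_2$ positive integers; $G_{n,m}$ is $c$-colorable if there is a map $G_{n,m}\to[c]$ with no rectangle having all four corners of the same color. $GRID(n,m,c)$ is the CNF formula with variables $x_{ijk}$ ($i\in[n]$, $j\in[m]$, $k\in[c]$) consisting of: for every $(i,j)$ the clause $\bigvee_{k=1}^c x_{ijk}$; and for all $1\le i<i'\le n$, $1\le j<j'\le m$ and every $k\in[c]$ the clause $\neg x_{ijk}\vee\neg x_{i'jk}\vee\neg x_{ij'k}\vee\neg x_{i'j'k}$. It is satisfiable iff $G_{n,m}$ is $c$-colorable. A resolution proof of unsatisfiability of a CNF $\varphi$ is a sequence of clauses, each either a clause of $\varphi$ or obtained as $A\vee B$ from earlier clauses $A\vee x$ and $B\vee\neg x$, ending with the empty clause; it is a tree resolution proof if its underlying derivation graph is a tree; size is the number of clauses. *)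

theory Defs
  imports Complex_Main
begin

definition grid :: "nat \<Rightarrow> nat \<Rightarrow> (nat \<times> nat) set" where
  "grid n m = {1..n} \<times> {1..m}"

definition is_rectangle :: "nat \<Rightarrow> nat \<Rightarrow> (nat \<times> nat) set \<Rightarrow> bool" where
  "is_rectangle n m R \<longleftrightarrow>
     (\<exists>a b c1 c2. a > 0 \<and> b > 0 \<and> c1 > 0 \<and> c2 > 0 \<and>
        R = {(a, b), (a + c1, b), (a + c1, b + c2), (a, b + c2)} \<and> R \<subseteq> grid n m)"

definition grid_colorable :: "nat \<Rightarrow> nat \<Rightarrow> nat \<Rightarrow> bool" where
  "grid_colorable n m c \<longleftrightarrow>
     (\<exists>\<chi>. (\<forall>p \<in> grid n m. \<chi> p \<in> {1..c}) \<and>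
          \<not> (\<exists>R k. is_rectangle n m R \<and> (\<forall>p \<in> R. \<chi> p = k)))"

datatype 'v literal = Pos 'v | Neg 'v

type_synonym 'v clause = "'v literal set"
type_synonym 'v cnf = "'v clause set"

text \<open>The variable $x_{ijk}$ is the triple \<open>(i, j, k)\<close>.\<close>

definition GRID :: "nat \<Rightarrow> nat \<Rightarrow> nat \<Rightarrow> (nat \<times> nat \<times> nat) cnf" where
  "GRID n m c =
     {{Pos (i, j, k) | k. k \<in> {1..c}} | i j. i \<in> {1..n} \<and> j \<in> {1..m}} \<union>
     {{Neg (i, j, k), Neg (i', j, k), Neg (i, j', k), Neg (i', j', k)} | i i' j j' k.
        1 \<le> i \<and> i < i' \<and> i' \<le> n \<and> 1 \<le> j \<and> j < j' \<and> j' \<le> m \<and> k \<in> {1..c}}"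

definition resolvent :: "'v clause \<Rightarrow> 'v clause \<Rightarrow> 'v clause \<Rightarrow> bool" where
  "resolvent C1 C2 C \<longleftrightarrow>
     (\<exists>A B x. C1 = insert (Pos x) A \<and> C2 = insert (Neg x) B \<and> C = A \<union> B)"

text \<open>A sequence of clauses does not determine its derivation graph, since a clause may be
  justified in several ways. The map \<open>d\<close> records the chosen justifications by position:
  \<open>None\<close> for a clause of the formula, \<open>Some (i, j)\<close> for a resolvent of the entries
  \<open>i\<close> and \<open>j\<close>.\<close>

definition derivation ::
    "'v cnf \<Rightarrow> 'v clause list \<Rightarrow> (nat \<Rightarrow> (nat \<times> nat) option) \<Rightarrow> bool" where
  "derivation \<phi> P d \<longleftrightarrow>
     (\<forall>k < length P. case d k of
          None \<Rightarrow> P ! k \<in> \<phi>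
        | Some (i, j) \<Rightarrow> i < k \<and> j < k \<and> resolvent (P ! i) (P ! j) (P ! k))"

definition resolution_proof :: "'v cnf \<Rightarrow> 'v clause list \<Rightarrow> bool" where
  "resolution_proof \<phi> P \<longleftrightarrow> P \<noteq> [] \<and> last P = {} \<and> (\<exists>d. derivation \<phi> P d)"

text \<open>Trees are understood in the undirected sense: an edge \<open>(u, v)\<close> may be traversed in both
  directions.\<close>

definition is_path :: "'a set \<Rightarrow> ('a \<times> 'a) set \<Rightarrow> 'a list \<Rightarrow> bool" where
  "is_path V E p \<longleftrightarrow> p \<noteq> [] \<and> distinct p \<and> set p \<subseteq> V \<and>
     successively (\<lambda>u v. (u, v) \<in> E \<or> (v, u) \<in> E) p"

definition is_cycle :: "'a set \<Rightarrow> ('a \<times> 'a) set \<Rightarrow> 'a list \<Rightarrow> bool" where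
  "is_cycle V E p \<longleftrightarrow> is_path V E p \<and> length p \<ge> 3 \<and>
     ((last p, hd p) \<in> E \<or> (hd p, last p) \<in> E)"

definition is_tree :: "'a set \<Rightarrow> ('a \<times> 'a) set \<Rightarrow> bool" where
  "is_tree V E \<longleftrightarrow> V \<noteq> {} \<and>
     (\<forall>u \<in> V. \<forall>v \<in> V. \<exists>p. is_path V E p \<and> hd p = u \<and> last p = v) \<and>
     \<not> (\<exists>p. is_cycle V E p)"

definition derivation_edges ::
    "'v clause list \<Rightarrow> (nat \<Rightarrow> (nat \<times> nat) option) \<Rightarrow> (nat \<times> nat) set" where
  "derivation_edges P d =
     {(u, k) | u k. k < length P \<and> (\<exists>i j. d k = Some (i, j) \<and> (u = i \<or> u = j))}"

text \<open>The derivation graph has one edge per premise. Using an entry as both premises of the same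
  step yields a double edge, i.e. a cycle, which a set of edges cannot express; hence the
  separate condition \<open>i \<noteq> j\<close>.\<close>

definition tree_resolution_proof :: "'v cnf \<Rightarrow> 'v clause list \<Rightarrow> bool" where
  "tree_resolution_proof \<phi> P \<longleftrightarrow> P \<noteq> [] \<and> last P = {} \<and>
     (\<exists>d. derivation \<phi> P d \<and>
          (\<forall>k < length P. \<forall>i j. d k = Some (i, j) \<longrightarrow> i \<noteq> j) \<and>
          is_tree {..<length P} (derivation_edges P d))"

definition proof_size :: "'v clause list \<Rightarrow> nat" where
  "proof_size P = length P"

lemma tree_resolution_proof_imp_resolution_proof:
  "tree_resolution_proof \<phi> P \<Longrightarrow> resolution_proof \<phi> P"
  by (auto simp: tree_resolution_proof_def resolution_proof_def)

end

theory Submission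
  imports Defs
begin

text \<open>
  Walk from the empty clause towards the axioms, keeping a partial assignment that falsifies the
  current clause. When the resolved variable \<open>(i, j, k)\<close> is undecided, set it to false if making it
  true would complete a rectangle of color \<open>k\<close>; otherwise explore both values and call the variable
  free. No rectangle clause is ever falsified, so a branch can only end at a cell \<open>(i, j)\<close> all of
  whose \<open>c\<close> variables are false. For each color \<open>k\<close>, either \<open>(i, j, k)\<close> itself is free, or it was
  forced by three true variables of color \<open>k\<close>, which are all free. So every branch has at least \<open>c\<close>
  binary choices, and the proof has size at least \<open>2 ^ c\<close>.
\<close>

text \<open>Edges run from premise to conclusion, so these are the positions used in deriving entry
  \<open>k\<close>, with \<open>k\<close> itself included.\<close>

definition descendants ::
    "'v clause list \<Rightarrow> (nat \<Rightarrow> (nat \<times> nat) option) \<Rightarrow> nat \<Rightarrow> nat set" where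
  "descendants P d k = {u. (u, k) \<in> (derivation_edges P d)\<^sup>*}"

lemma derivation_edges_less:
  assumes "derivation \<phi> P d" "(u, k) \<in> derivation_edges P d"
  shows "u < k"
  using assms by (auto simp: derivation_def derivation_edges_def split: option.splits prod.splits)

lemma descendants_le:
  assumes "derivation \<phi> P d" "u \<in> descendants P d k"
  shows "u \<le> k"
proof -
  from assms(2) have "(u, k) \<in> (derivation_edges P d)\<^sup>*" by (simp add: descendants_def)
  then show ?thesis
    by (induction rule: rtrancl_induct) (auto dest: derivation_edges_less[OF assms(1)])
qed

lemma finite_descendants: "derivation \<phi> P d \<Longrightarrow> finite (descendants P d k)"
  by (rule finite_subset[of _ "{..k}"]) (auto dest: descendants_le)

lemma descendants_refl: "k \<in> descendants P d k"
  by (simp add: descendants_def)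

lemma descendants_mono:
  "(i, k) \<in> derivation_edges P d \<Longrightarrow> descendants P d i \<subseteq> descendants P d k"
  by (auto simp: descendants_def intro: rtrancl_into_rtrancl)

text \<open>Vertices of a path may not repeat: if \<open>v\<close> already lies on \<open>p\<close>,
  the path is cut at \<open>v\<close> instead of prolonged.\<close>

lemma is_path_extend:
  assumes "is_path V E p" "(last p, v) \<in> E \<or> (v, last p) \<in> E" "v \<in> V"
  shows "\<exists>q. is_path V E q \<and> hd q = hd p \<and> last q = v"
proof (cases "v \<in> set p")
  case True
  then obtain xs ys where p: "p = xs @ v # ys" by (auto simp: in_set_conv_decomp)
  then have "is_path V E (xs @ [v])"
    using assms(1) by (auto simp: is_path_def successively_append_iff)
  moreover have "hd (xs @ [v]) = hd p" using p by (cases xs) auto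
  ultimately show ?thesis by (intro exI[of _ "xs @ [v]"]) auto
next
  case False
  then have "is_path V E (p @ [v])"
    using assms by (auto simp: is_path_def successively_append_iff)
  then show ?thesis using assms(1) by (intro exI[of _ "p @ [v]"]) (auto simp: is_path_def)
qed

lemma rtrancl_imp_is_path:
  assumes "(u, v) \<in> {(a, b). ((a, b) \<in> E \<or> (b, a) \<in> E) \<and> b \<in> V}\<^sup>*" "u \<in> V"
  shows "\<exists>p. is_path V E p \<and> hd p = u \<and> last p = v"
  using assms(1)
proof (induction rule: rtrancl_induct)
  case base
  show ?case using assms(2) by (intro exI[of _ "[u]"]) (auto simp: is_path_def)
next
  case (step v w)
  then obtain p where p: "is_path V E p" "hd p = u" "last p = v" by blast
  then show ?case using step(2) is_path_extend[OF p(1), of w] by auto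
qed

text \<open>A common descendant of two premises of \<open>k\<close> yields a path between them inside \<open>{..<k}\<close>, which
  \<open>k\<close> closes to a cycle.\<close>

lemma descendants_disjoint:
  assumes der: "derivation \<phi> P d" and k: "k < length P" "d k = Some (i, j)" and "i \<noteq> j"
    and acyclic: "\<not> (\<exists>p. is_cycle {..<length P} (derivation_edges P d) p)"
  shows "descendants P d i \<inter> descendants P d j = {}"
proof (rule ccontr)
  let ?E = "derivation_edges P d"
  let ?S = "{(a, b). ((a, b) \<in> ?E \<or> (b, a) \<in> ?E) \<and> b \<in> {..<k}}"
  assume "descendants P d i \<inter> descendants P d j \<noteq> {}"
  then obtain v where v: "(v, i) \<in> ?E\<^sup>*" "(v, j) \<in> ?E\<^sup>*" by (auto simp: descendants_def)
  have ik: "(i, k) \<in> ?E" and jk: "(j, k) \<in> ?E" using k by (auto simp: derivation_edges_def)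
  have "i < k" "j < k" using derivation_edges_less[OF der] ik jk by auto
  \<comment> \<open>Edges increase positions, so a directed walk ending below \<open>k\<close> stays
    below \<open>k\<close> throughout and can be traversed both ways inside
    \<open>?S\<close>.\<close>
  have up: "(v, w) \<in> ?S\<^sup>* \<and> (w, v) \<in> ?S\<^sup>*" if "(v, w) \<in> ?E\<^sup>*" "w < k" for w
    using that
  proof (induction rule: rtrancl_induct)
    case (step x y)
    moreover have "x < y" using derivation_edges_less[OF der] step(2) .
    ultimately have "(x, y) \<in> ?S" "(y, x) \<in> ?S" "(v, x) \<in> ?S\<^sup>*" "(x, v) \<in> ?S\<^sup>*" by auto
    then show ?case by (meson converse_rtrancl_into_rtrancl rtrancl_into_rtrancl)
  qed simp
  have "(i, j) \<in> ?S\<^sup>*"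
    using up v \<open>i < k\<close> \<open>j < k\<close> by (meson rtrancl_trans)
  then obtain p where p: "is_path {..<k} ?E p" "hd p = i" "last p = j"
    using rtrancl_imp_is_path[of i j ?E "{..<k}"] \<open>i < k\<close> by auto
  \<comment> \<open>With \<open>k\<close> appended this gives the three vertices that a cycle
    needs.\<close>
  have "length p \<ge> 2"
    using p \<open>i \<noteq> j\<close> by (cases p; cases "tl p") (auto simp: is_path_def)
  moreover have "is_path {..<length P} ?E (p @ [k])"
    using p k(1) jk by (auto simp: is_path_def successively_append_iff)
  ultimately have "is_cycle {..<length P} ?E (p @ [k])"
    using p ik by (auto simp: is_cycle_def is_path_def)
  then show False using acyclic by blast
qed

definition falsifies :: "'v set \<Rightarrow> 'v set \<Rightarrow> 'v clause \<Rightarrow> bool" where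
  "falsifies T N C \<longleftrightarrow> (\<forall>v. (Pos v \<in> C \<longrightarrow> v \<in> N) \<and> (Neg v \<in> C \<longrightarrow> v \<in> T))"

text \<open>\<open>(i', j')\<close> is the opposite corner. Inequalities instead of an order let
  \<open>x\<close> be any of the four corners. Applied to the elements of \<open>T\<close> itself,
  the negated predicate says that \<open>T\<close> contains no monochromatic rectangle.\<close>

definition completes_rectangle ::
    "(nat \<times> nat \<times> nat) set \<Rightarrow> nat \<times> nat \<times> nat \<Rightarrow> bool" where
  "completes_rectangle T x \<longleftrightarrow> (case x of (i, j, k) \<Rightarrow>
     \<exists>i' j'. i' \<noteq> i \<and> j' \<noteq> j \<and> (i', j, k) \<in> T \<and> (i, j', k) \<in> T \<and> (i', j', k) \<in> T)"

lemma completes_rectangle_mono: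
  "completes_rectangle T x \<Longrightarrow> T \<subseteq> T' \<Longrightarrow> completes_rectangle T' x"
  by (auto simp: completes_rectangle_def)

text \<open>A new rectangle must have \<open>x\<close> as a corner. Seen from \<open>x\<close>, its
  other three corners already lie in \<open>T\<close>, so \<open>x\<close> would have completed
  it.\<close>

lemma rectangle_free_insert:
  assumes "\<forall>y \<in> T. \<not> completes_rectangle T y" "\<not> completes_rectangle T x"
  shows "\<forall>y \<in> insert x T. \<not> completes_rectangle (insert x T) y"
proof (rule ballI, rule notI)
  fix y assume y: "y \<in> insert x T" "completes_rectangle (insert x T) y"
  obtain i j k where yeq: "y = (i, j, k)" by (cases y)
  from y(2) obtain i' j' where ij: "i' \<noteq> i" "j' \<noteq> j" and corners:
      "(i', j, k) \<in> insert x T" "(i, j', k) \<in> insert x T" "(i', j', k) \<in> insert x T"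
    unfolding yeq completes_rectangle_def by auto
  have threat: "\<not> ((a', b, k) \<in> T \<and> (a, b', k) \<in> T \<and> (a', b', k) \<in> T)"
    if "(a, b, k) \<in> insert x T" "a' \<noteq> a" "b' \<noteq> b" for a a' b b'
  proof -
    have "\<not> completes_rectangle T (a, b, k)" using that(1) assms by blast
    then show ?thesis using that(2,3) unfolding completes_rectangle_def by auto
  qed
  \<comment> \<open>\<open>threat\<close> is applied at the corner \<open>x\<close> when
    \<open>x\<close> is one of the other three corners, and at \<open>y\<close> when it is
    not.\<close>
  consider "x \<notin> {(i', j, k), (i, j', k), (i', j', k)}" | "x = (i', j, k)" | "x = (i, j', k)"
    | "x = (i', j', k)" by blast
  then show False
  proof cases
    case 1
    then show ?thesis using threat[of i j i' j'] y(1) yeq ij corners by auto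
  next
    case 2
    then show ?thesis using threat[of i' j i j'] y(1) yeq ij corners by auto
  next
    case 3
    then show ?thesis using threat[of i j' i' j] y(1) yeq ij corners by auto
  next
    case 4
    then show ?thesis using threat[of i' j' i j] y(1) yeq ij corners by auto
  qed
qed

text \<open>\<open>T\<close> and \<open>N\<close> are the variables set to true and to false; \<open>F\<close> is the set of free ones.\<close>

definition legal_state ::
    "(nat \<times> nat \<times> nat) set \<Rightarrow> (nat \<times> nat \<times> nat) set \<Rightarrow> (nat \<times> nat \<times> nat) set \<Rightarrow> bool" where
  "legal_state T N F \<longleftrightarrow> finite F \<and> T \<subseteq> F \<and> (\<forall>x \<in> N. x \<in> F \<or> completes_rectangle T x) \<and>
     (\<forall>x \<in> T. \<not> completes_rectangle T x)"

lemma legal_state_forced: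
  "legal_state T N F \<Longrightarrow> completes_rectangle T x \<Longrightarrow> legal_state T (insert x N) F"
  by (auto simp: legal_state_def)

lemma legal_state_free_False:
  "legal_state T N F \<Longrightarrow> legal_state T (insert x N) (insert x F)"
  by (auto simp: legal_state_def)

text \<open>Forced variables stay forced because \<open>completes_rectangle\<close> is monotone in
  \<open>T\<close>.\<close>

lemma legal_state_free_True:
  assumes "legal_state T N F" "\<not> completes_rectangle T x"
  shows "legal_state (insert x T) N (insert x F)"
proof -
  have "completes_rectangle (insert x T) y" if "completes_rectangle T y" for y
    using that completes_rectangle_mono by blast
  then show ?thesis
    using assms rectangle_free_insert[of T x] unfolding legal_state_def by blast
qed

lemma axiom_falsified_imp_card_free:
  assumes st: "legal_state T N F" and "C \<in> GRID n m c" "falsifies T N C"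
  shows "c \<le> card F"
proof -
  consider i j where "C = {Pos (i, j, k) | k. k \<in> {1..c}}"
    | i i' j j' k where "C = {Neg (i, j, k), Neg (i', j, k), Neg (i, j', k), Neg (i', j', k)}"
      "i < i'" "j < j'"
    using assms(2) unfolding GRID_def by blast
  then show ?thesis
  proof cases
    case 1
    have "{1..c} \<subseteq> (snd \<circ> snd) ` F"
    proof
      fix k assume "k \<in> {1..c}"
      then have "(i, j, k) \<in> N" using assms(3) 1 by (auto simp: falsifies_def)
      \<comment> \<open>If \<open>(i, j, k)\<close> is forced, the true corner
        \<open>(i', j, k)\<close> is free by \<open>T \<subseteq> F\<close> and also has color
        \<open>k\<close>.\<close>
      then consider "(i, j, k) \<in> F" | i' where "(i', j, k) \<in> F"
        using st by (fastforce simp: legal_state_def completes_rectangle_def)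
      then show "k \<in> (snd \<circ> snd) ` F" by cases force+
    qed
    then have "card {1..c} \<le> card F"
      using st surj_card_le[of F "{1..c}" "snd \<circ> snd"] unfolding legal_state_def by blast
    then show ?thesis by simp
  next
    case 2
    then have T: "(i, j, k) \<in> T" "(i', j, k) \<in> T" "(i, j', k) \<in> T" "(i', j', k) \<in> T"
      using assms(3) by (simp_all add: falsifies_def)
    have "i' \<noteq> i" "j' \<noteq> j" using 2 by simp_all
    with T have "completes_rectangle T (i, j, k)"
      unfolding completes_rectangle_def prod.case by blast
    then show ?thesis using st T(1) unfolding legal_state_def by blast
  qed
qed

text \<open>The bound is 2 to the power \<open>c - card F\<close>, multiplied out to avoid truncated
  subtraction. Premises sit at smaller positions, hence the strong induction on
  \<open>k\<close>.\<close>

lemma card_descendants_ge: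
  assumes der: "derivation (GRID n m c) P d"
    and dist: "\<forall>k < length P. \<forall>i j. d k = Some (i, j) \<longrightarrow> i \<noteq> j"
    and acyclic: "\<not> (\<exists>p. is_cycle {..<length P} (derivation_edges P d) p)"
    and "k < length P" "legal_state T N F" "falsifies T N (P ! k)"
  shows "2 ^ c \<le> 2 ^ card F * card (descendants P d k)"
  using assms(4-)
proof (induction k arbitrary: T N F rule: less_induct)
  case (less k)
  let ?D = "descendants P d"
  note fin = finite_descendants[OF der]
  show ?case
  proof (cases "d k")
    case None
    then have "P ! k \<in> GRID n m c" using der less.prems(1) by (auto simp: derivation_def)
    then have "c \<le> card F" using axiom_falsified_imp_card_free less.prems(2,3) by blast
    then have "(2::nat) ^ c \<le> 2 ^ card F" by simp
    moreover have "card (?D k) \<ge> 1"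
      using fin[of k] descendants_refl[of k P d]
      by (metis One_nat_def Suc_leI card_gt_0_iff empty_iff)
    ultimately show ?thesis by (metis mult.right_neutral mult_le_mono)
  next
    case (Some ij)
    then obtain i j where ij: "d k = Some (i, j)" by (cases ij) auto
    then have less': "i < k" "j < k" and "resolvent (P ! i) (P ! j) (P ! k)"
      using der less.prems(1) by (auto simp: derivation_def split: option.splits)
    then obtain A B x where AB: "P ! i = insert (Pos x) A" "P ! j = insert (Neg x) B"
        "P ! k = A \<union> B"
      by (auto simp: resolvent_def)
    have "?D i \<subseteq> ?D k" "?D j \<subseteq> ?D k"
      using ij less.prems(1) by (auto intro!: descendants_mono simp: derivation_edges_def)
    then have sub: "?D i \<union> ?D j \<subseteq> ?D k" "card (?D i) \<le> card (?D k)" "card (?D j) \<le> card (?D k)"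
      using fin by (auto intro: card_mono)
    \<comment> \<open>Apart from the resolved literal, each premise is contained in
      \<open>P ! k\<close> and so is already falsified. It remains to falsify \<open>Pos x\<close>
      by \<open>x \<in> N'\<close>, or \<open>Neg x\<close> by \<open>x \<in> T'\<close> in the case
      of \<open>j\<close>.\<close>
    have IHi: "2 ^ c \<le> 2 ^ card F' * card (?D i)"
      if "legal_state T' N' F'" "x \<in> N'" "T \<subseteq> T'" "N \<subseteq> N'" for T' N' F'
      using less.IH[OF less'(1) _ that(1)] less' less.prems AB that(2-)
      by (auto simp: falsifies_def subset_iff)
    have IHj: "2 ^ c \<le> 2 ^ card F' * card (?D j)"
      if "legal_state T' N' F'" "x \<in> T'" "T \<subseteq> T'" "N \<subseteq> N'" for T' N' F'
      using less.IH[OF less'(2) _ that(1)] less' less.prems AB that(2-)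
      by (auto simp: falsifies_def subset_iff)
    \<comment> \<open>In the first three cases a single premise is followed and \<open>F\<close>
      does not grow; only the last case branches.\<close>
    consider "x \<in> T" | "x \<in> N" | "completes_rectangle T x" | "\<not> completes_rectangle T x"
      by blast
    then show ?thesis
    proof cases
      case 1
      then have "2 ^ c \<le> 2 ^ card F * card (?D j)" using IHj less.prems(2) by simp
      then show ?thesis using sub(3) by (meson le_trans mult_le_mono2)
    next
      case 2
      then have "2 ^ c \<le> 2 ^ card F * card (?D i)" using IHi less.prems(2) by simp
      then show ?thesis using sub(2) by (meson le_trans mult_le_mono2)
    next
      case 3
      then have "2 ^ c \<le> 2 ^ card F * card (?D i)"
        using IHi[OF legal_state_forced[OF less.prems(2) 3]] by auto
      then show ?thesis using sub(2) by (meson le_trans mult_le_mono2)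
    next
      case 4
      let ?F = "insert x F"
      have "2 ^ c \<le> 2 ^ card ?F * card (?D i)"
        using IHi[OF legal_state_free_False[OF less.prems(2), of x]] by blast
      moreover have "2 ^ c \<le> 2 ^ card ?F * card (?D j)"
        using IHj[OF legal_state_free_True[OF less.prems(2) 4]] by auto
      \<comment> \<open>The factor 2 gained from the two disjoint subtrees pays for the new free
        variable \<open>x\<close>.\<close>
      ultimately have "2 * 2 ^ c \<le> 2 ^ card ?F * (card (?D i) + card (?D j))"
        by (simp add: distrib_left)
      also have "card (?D i) + card (?D j) = card (?D i \<union> ?D j)"
        using fin descendants_disjoint[OF der less.prems(1) ij _ acyclic] dist less.prems(1) ij
        by (intro card_Un_disjoint[symmetric]) auto
      also have "\<dots> \<le> card (?D k)" using sub(1) fin by (intro card_mono)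
      also have "(2::nat) ^ card ?F \<le> 2 ^ Suc (card F)"
        using less.prems(2) by (intro power_increasing) (auto simp: legal_state_def card_insert_if)
      finally show ?thesis by simp
    qed
  qed
qed

lemma tree_resolution_proof_GRID_length:
  assumes "tree_resolution_proof (GRID n m c) P"
  shows "2 ^ c \<le> length P"
proof -
  obtain d where P: "P \<noteq> []" "last P = {}" and der: "derivation (GRID n m c) P d"
    and d: "\<forall>k < length P. \<forall>i j. d k = Some (i, j) \<longrightarrow> i \<noteq> j"
      "\<not> (\<exists>p. is_cycle {..<length P} (derivation_edges P d) p)"
    using assms by (auto simp: tree_resolution_proof_def is_tree_def)
  let ?k = "length P - 1"
  have k: "?k < length P" "P ! ?k = {}" using P by (auto simp: last_conv_nth)
  \<comment> \<open>The walk starts at the final empty clause, which the empty assignment falsifies,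
    with no free variable spent.\<close>
  have "2 ^ c \<le> 2 ^ card ({} :: (nat \<times> nat \<times> nat) set) * card (descendants P d ?k)"
    using card_descendants_ge[OF der d k(1), of "{}" "{}" "{}"] k(2)
    by (simp add: legal_state_def falsifies_def)
  also have "\<dots> \<le> card {..?k}"
    using card_mono[of "{..?k}" "descendants P d ?k"] descendants_le[OF der] by auto
  also have "\<dots> = length P" using k(1) by simp
  finally show ?thesis .
qed

theorem theorem5p5:
  fixes n m c :: nat and P :: "(nat \<times> nat \<times> nat) clause list"
  assumes "n > 0" and "m > 0" and "c > 0"
    and "\<not> grid_colorable n m c"
    and "c \<ge> 9288"
    and "tree_resolution_proof (GRID n m c) P"
  shows "real (proof_size P) \<ge> 2 powr (0.836 * real c)"
proof -
  \<comment> \<open>The bound \<open>2 ^ c\<close> proved above is stronger, since 0.836 is below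
    1.\<close>
  have "2 powr (0.836 * real c) \<le> 2 powr real c" by (intro powr_mono) auto
  also have "\<dots> = real (2 ^ c)" by (simp add: powr_realpow)
  also have "\<dots> \<le> real (proof_size P)"
    using tree_resolution_proof_GRID_length[OF assms(6)] unfolding proof_size_def of_nat_le_iff .
  finally show ?thesis .
qed

end
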